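(* Assume that $\Gamma=\{0\}$ and let $(C_*,\partial,\ell)$ be a Floer-type complex over $\Lambda^{\mathcal{K},\{0\}}=\mathcal{K}$, where $\mathcal{K}$ is a field. For each $k\in\mathbb{Z}$ write $\partial_{k+1}\colon C_{k+1}\to C_k$ for the degree-$(k+1)$ part of $\partial$, and $Z_k=\ker\partial_k$, so that $\partial_{k+1}$ has image contained in $Z_k$. Let $((y_1,\dots,y_n),(x_1,\dots,x_m))$ be a singular value decomposition for $\partial_{k+1}\colon C_{k+1}\to Z_k$ and let $r=\mathrm{rank}(\partial_{k+1})$. Then the degree-$k$ part of the (persistent homology) barcode of $C_*$ consists precisely of: - an interval $[\ell(x_i),\ell(y_i))$ for each $i\in\{1,\dots,r\}$ such that $\ell(y_i)>\ell(x_i)$; and - an interval $[\ell(x_i),\infty)$ for each $i\in\{r+1,\dots,m\}$.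
   Context: When $\Gamma=\{0\}$ the Novikov field is $\mathcal{K}$ with the trivial valuation $\nu$: $\nu(x)=0$ for $x\neq 0$, $\nu(0)=\infty$. **Orthogonalizable spaces.** An orthogonalizable $\mathcal{K}$-space is a finite-dimensional $\mathcal{K}$-vector space $C$ with a function $\ell\colon C\to\mathbb{R}\cup\{-\infty\}$ satisfying: $\ell(x)=-\infty$ iff $x=0$; $\ell(\lambda x)=\ell(x)-\nu(\lambda)$; $\ell(x+y)\leq\max\{\ell(x),\ell(y)\}$; and admitting an orthogonal basis, where a finite ordered collection $(w_1,\dots,w_r)$ is orthogonal if $\ell(\sum_i\lambda_iw_i)=\max_i\ell(\lambda_iw_i)$ for all $\lambda_i\in\mathcal{K}$. Subspaces with restricted $\ell$ are again orthogonalizable. **Singular value decomposition.** Let $A\colon C\to D$ be a linear map of rank $r$ between orthogonalizable spaces. A singular value decomposition of $A$ is a choice of orthogonal ordered bases $(y_1,\dots,y_n)$ for $C$ and $(x_1,\dots,x_m)$ for $D$ such that: $(y_{r+1},\dots,y_n)$ is an orthogonal ordered basis for $\ker A$; $(x_1,\dots,x_r)$ is an orthogonal ordered basis for $\mathrm{Im}\,A$; $Ay_i=x_i$ for $i\leq r$; $\ell_C(y_1)-\ell_D(x_1)\geq\cdots\geq\ell_C(y_r)-\ell_D(x_r)$. **Floer-type complex.** $(C_*,\partial,\ell)$ is a chain complex $C_*=\bigoplus_{k\in\mathbb{Z}}C_k$ over $\mathcal{K}$ ($\partial C_k\subset C_{k-1}$) with a function $\ell$ such that each $(C_k,\ell|_{C_k})$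 is orthogonalizable and $\ell(\partial x)\leq\ell(x)$ for $x\in C_k$. **Persistent homology barcode.** For $t\in\mathbb{R}$ let $C_k^t=\{c\in C_k\mid\ell(c)\leq t\}$; $C_*^t$ is a subcomplex of $C_*$, and its degree-$k$ homologies $H_k^t(C_* )$ with the inclusion-induced maps $H_k^s(C_* )\to H_k^t(C_* )$ for $s\leq t$ form a pointwise finite-dimensional persistence module over $\mathcal{K}$. For an interval $I\subset\mathbb{R}$ the interval module $\mathcal{K}_I$ has $(\mathcal{K}_I)_t=\mathcal{K}$ for $t\in I$ and $0$ otherwise, with structure maps the identity when $s,t\in I$ and zero otherwise. By a standard structure theorem $\{H_k^t(C_* )\}_{t\in\mathbb{R}}$ is isomorphic to a direct sum $\bigoplus_\alpha\mathcal{K}_{I_\alpha}$, with the multiset of intervals $I_\alpha$ uniquely determined; this multiset is by definition the degree-$k$ part of the barcode of $C_*$. *)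

theory Defs
  imports "HOL-Analysis.Analysis" "HOL-Library.Set_Algebras" "HOL-Library.Multiset"
begin

section \<open>Orthogonalizable spaces and singular value decompositions\<close>

text \<open>
  Vector spaces over the field \<^typ>\<open>'k\<close> are subspaces of an ambient type with scalar
  multiplication \<^term>\<open>s\<close>. The Novikov field for the trivial group is \<^typ>\<open>'k\<close>
  itself with the trivial valuation.
\<close>

definition trivial_valuation :: "'k::field \<Rightarrow> ereal" where
  "trivial_valuation c = (if c = 0 then \<infinity> else 0)"

text \<open>
  The supremum below is over a finite set, so it is a maximum; over the empty set it is
  \<open>- \<infinity>\<close>, the value of \<open>l\<close> at the empty sum.
\<close>

definition orthogonal_family ::
    "('k::field \<Rightarrow> 'v::ab_group_add \<Rightarrow> 'v) \<Rightarrow> ('v \<Rightarrow> ereal) \<Rightarrow> nat set \<Rightarrow> (nat \<Rightarrow> 'v) \<Rightarrow> bool" where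
  "orthogonal_family s l J w \<longleftrightarrow> finite J \<and>
     (\<forall>c. l (\<Sum>i\<in>J. s (c i) (w i)) = (SUP i\<in>J. l (s (c i) (w i))))"

definition basis_family ::
    "('k::field \<Rightarrow> 'v::ab_group_add \<Rightarrow> 'v) \<Rightarrow> 'v set \<Rightarrow> nat set \<Rightarrow> (nat \<Rightarrow> 'v) \<Rightarrow> bool" where
  "basis_family s V J w \<longleftrightarrow> finite J \<and> inj_on w J \<and>
     \<not> module.dependent s (w ` J) \<and> module.span s (w ` J) = V"

definition orthogonal_basis ::
    "('k::field \<Rightarrow> 'v::ab_group_add \<Rightarrow> 'v) \<Rightarrow> ('v \<Rightarrow> ereal) \<Rightarrow> 'v set \<Rightarrow> nat set \<Rightarrow> (nat \<Rightarrow> 'v) \<Rightarrow> bool" where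
  "orthogonal_basis s l V J w \<longleftrightarrow> basis_family s V J w \<and> orthogonal_family s l J w"

text \<open>
  The first conjunct on \<open>l\<close> restricts its values on \<open>V\<close> to the reals together with
  \<open>- \<infinity>\<close>. Finite-dimensionality is contained in the existence of the finite basis.
\<close>

definition orthogonalizable ::
    "('k::field \<Rightarrow> 'v::ab_group_add \<Rightarrow> 'v) \<Rightarrow> ('v \<Rightarrow> ereal) \<Rightarrow> 'v set \<Rightarrow> bool" where
  "orthogonalizable s l V \<longleftrightarrow>
     module.subspace s V \<and>
     (\<forall>x\<in>V. l x \<noteq> \<infinity>) \<and>
     (\<forall>x\<in>V. l x = -\<infinity> \<longleftrightarrow> x = 0) \<and>
     (\<forall>c. \<forall>x\<in>V. l (s c x) = l x - trivial_valuation c) \<and>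
     (\<forall>x\<in>V. \<forall>y\<in>V. l (x + y) \<le> max (l x) (l y)) \<and>
     (\<exists>r w. orthogonal_basis s l V {1..r} w)"

text \<open>
  A singular value decomposition \<open>((y\<^sub>1,\<dots>,y\<^sub>n), (x\<^sub>1,\<dots>,x\<^sub>m))\<close> of \<open>A : V \<rightarrow> W\<close>. Only the values
  of \<open>A\<close> on \<open>V\<close> matter.
\<close>

definition singular_value_decomposition ::
    "('k::field \<Rightarrow> 'v::ab_group_add \<Rightarrow> 'v) \<Rightarrow> ('v \<Rightarrow> ereal) \<Rightarrow> 'v set \<Rightarrow>
     ('k \<Rightarrow> 'w::ab_group_add \<Rightarrow> 'w) \<Rightarrow> ('w \<Rightarrow> ereal) \<Rightarrow> 'w set \<Rightarrow>
     ('v \<Rightarrow> 'w) \<Rightarrow> nat \<Rightarrow> (nat \<Rightarrow> 'v) \<Rightarrow> nat \<Rightarrow> (nat \<Rightarrow> 'w) \<Rightarrow> bool" where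
  "singular_value_decomposition sV lV V sW lW W A n y m x \<longleftrightarrow>
     (let r = vector_space.dim sW (A ` V) in
       orthogonal_basis sV lV V {1..n} y \<and>
       orthogonal_basis sW lW W {1..m} x \<and>
       orthogonal_basis sV lV {v \<in> V. A v = 0} {r+1..n} y \<and>
       orthogonal_basis sW lW (A ` V) {1..r} x \<and>
       (\<forall>i\<in>{1..r}. A (y i) = x i) \<and>
       (\<forall>i\<in>{1..r}. \<forall>j\<in>{1..r}. i \<le> j \<longrightarrow> lV (y j) - lW (x j) \<le> lV (y i) - lW (x i)))"

section \<open>Floer-type complexes\<close>

text \<open>
  The type \<^typ>\<open>'v\<close> is the total space of the complex, the internal direct sum of the
  subspaces \<open>C k\<close>.
\<close>

definition internal_direct_sum :: "('i \<Rightarrow> 'v::ab_group_add set) \<Rightarrow> bool" where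
  "internal_direct_sum C \<longleftrightarrow>
     (\<forall>v. \<exists>!f. (\<forall>k. f k \<in> C k) \<and> finite {k. f k \<noteq> 0} \<and> v = (\<Sum>k | f k \<noteq> 0. f k))"

locale floer_type_complex = vector_space s
  for s :: "'k::field \<Rightarrow> 'v::ab_group_add \<Rightarrow> 'v" +
  fixes C :: "int \<Rightarrow> 'v set" and d :: "'v \<Rightarrow> 'v" and l :: "'v \<Rightarrow> ereal"
  assumes direct_sum: "internal_direct_sum C"
    and orthogonalizable: "orthogonalizable s l (C k)"
    and linear_d: "Vector_Spaces.linear s s d"
    and degree_d: "d ` C k \<subseteq> C (k - 1)"
    and d_d: "d (d v) = 0"
    and filtration_d: "v \<in> C k \<Longrightarrow> l (d v) \<le> l v"

definition cycles :: "(int \<Rightarrow> 'v::ab_group_add set) \<Rightarrow> ('v \<Rightarrow> 'v) \<Rightarrow> int \<Rightarrow> 'v set" where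
  "cycles C d k = {v \<in> C k. d v = 0}"

definition boundaries :: "(int \<Rightarrow> 'v::ab_group_add set) \<Rightarrow> ('v \<Rightarrow> 'v) \<Rightarrow> int \<Rightarrow> 'v set" where
  "boundaries C d k = d ` C (k + 1)"

definition sublevel :: "(int \<Rightarrow> 'v::ab_group_add set) \<Rightarrow> ('v \<Rightarrow> ereal) \<Rightarrow> real \<Rightarrow> int \<Rightarrow> 'v set" where
  "sublevel C l t k = {v \<in> C k. l v \<le> ereal t}"

section \<open>Persistence modules over the reals and their barcodes\<close>

text \<open>
  Data of a persistence module: a vector space with carrier \<open>pm_space P t\<close> for each real \<open>t\<close>,
  and structure maps \<open>pm_map P a b\<close> from level \<open>a\<close> to level \<open>b\<close>, meaningful for \<open>a \<le> b\<close>.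
\<close>

record ('k, 'a) persistence_module =
  pm_space :: "real \<Rightarrow> 'a set"
  pm_zero :: "real \<Rightarrow> 'a"
  pm_add :: "real \<Rightarrow> 'a \<Rightarrow> 'a \<Rightarrow> 'a"
  pm_scale :: "real \<Rightarrow> 'k \<Rightarrow> 'a \<Rightarrow> 'a"
  pm_map :: "real \<Rightarrow> real \<Rightarrow> 'a \<Rightarrow> 'a"

definition pm_iso :: "('k, 'a) persistence_module \<Rightarrow> ('k, 'b) persistence_module \<Rightarrow> bool" where
  "pm_iso P Q \<longleftrightarrow> (\<exists>\<phi>.
     (\<forall>t. bij_betw (\<phi> t) (pm_space P t) (pm_space Q t)) \<and>
     (\<forall>t. \<forall>u\<in>pm_space P t. \<forall>v\<in>pm_space P t.
        \<phi> t (pm_add P t u v) = pm_add Q t (\<phi> t u) (\<phi> t v)) \<and>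
     (\<forall>t c. \<forall>u\<in>pm_space P t. \<phi> t (pm_scale P t c u) = pm_scale Q t c (\<phi> t u)) \<and>
     (\<forall>a b. a \<le> b \<longrightarrow> (\<forall>u\<in>pm_space P a. \<phi> b (pm_map P a b u) = pm_map Q a b (\<phi> a u))))"

definition interval_module :: "real set \<Rightarrow> ('k::field, 'k) persistence_module" where
  "interval_module I = \<lparr>
     pm_space = (\<lambda>t. if t \<in> I then UNIV else {0}),
     pm_zero = (\<lambda>t. 0),
     pm_add = (\<lambda>t u v. u + v),
     pm_scale = (\<lambda>t c u. c * u),
     pm_map = (\<lambda>a b u. if a \<in> I \<and> b \<in> I then u else 0) \<rparr>"

text \<open>
  The elements are the extensional functions on the index set \<open>A\<close> with finite support.
\<close>

definition pm_direct_sum ::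
    "'i set \<Rightarrow> ('i \<Rightarrow> ('k, 'a) persistence_module) \<Rightarrow> ('k, 'i \<Rightarrow> 'a) persistence_module" where
  "pm_direct_sum A P = \<lparr>
     pm_space = (\<lambda>t. {f \<in> (\<Pi>\<^sub>E i\<in>A. pm_space (P i) t). finite {i \<in> A. f i \<noteq> pm_zero (P i) t}}),
     pm_zero = (\<lambda>t. \<lambda>i\<in>A. pm_zero (P i) t),
     pm_add = (\<lambda>t f g. \<lambda>i\<in>A. pm_add (P i) t (f i) (g i)),
     pm_scale = (\<lambda>t c f. \<lambda>i\<in>A. pm_scale (P i) t c (f i)),
     pm_map = (\<lambda>a b f. \<lambda>i\<in>A. pm_map (P i) a b (f i)) \<rparr>"

text \<open>
  A multiset of intervals is given by its multiplicity function \<open>\<mu>\<close>. Multiplicities are finite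
  because the modules considered are pointwise finite-dimensional, but \<open>\<mu>\<close> may have infinite
  support, so that uniqueness in \<open>is_barcode\<close> refers to all possible interval decompositions.
  Intervals are nonempty; empty ones would contribute zero summands.
\<close>

definition interval_decomposition ::
    "('k::field, 'a) persistence_module \<Rightarrow> (real set \<Rightarrow> nat) \<Rightarrow> bool" where
  "interval_decomposition P \<mu> \<longleftrightarrow>
     (\<forall>I. \<mu> I \<noteq> 0 \<longrightarrow> is_interval I \<and> I \<noteq> {}) \<and>
     pm_iso P (pm_direct_sum {(I, j). j < \<mu> I} (\<lambda>(I, j). interval_module I))"

definition is_barcode ::
    "('k::field, 'a) persistence_module \<Rightarrow> (real set \<Rightarrow> nat) \<Rightarrow> bool" where
  "is_barcode P \<mu> \<longleftrightarrow> interval_decomposition P \<mu> \<and>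
     (\<forall>\<mu>'. interval_decomposition P \<mu>' \<longrightarrow> \<mu>' = \<mu>)"

text \<open>
  The degree-\<open>k\<close> homology of the sublevel complexes. With \<open>B t\<close> the boundaries and \<open>Z t\<close> the
  cycles of level \<open>t\<close>, its elements are the cosets \<open>z +o B t\<close>, \<open>z \<in> Z t\<close>, and \<open>+\<close> on cosets is
  the elementwise sum of sets. Adding \<open>B t\<close> to \<open>s c ` (z +o B t)\<close> gives the coset of \<open>s c z\<close> also
  for \<open>c = 0\<close>, and adding \<open>B b\<close> to \<open>z +o B a\<close> gives \<open>z +o B b\<close> when \<open>a \<le> b\<close>, so the structure maps
  are induced by the inclusions.
\<close>

definition persistent_homology ::
    "('k::field \<Rightarrow> 'v::ab_group_add \<Rightarrow> 'v) \<Rightarrow> (int \<Rightarrow> 'v set) \<Rightarrow> ('v \<Rightarrow> 'v) \<Rightarrow> ('v \<Rightarrow> ereal) \<Rightarrow> int \<Rightarrow>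
     ('k, 'v set) persistence_module" where
  "persistent_homology s C d l k =
     (let Z = (\<lambda>t. cycles (sublevel C l t) d k);
          B = (\<lambda>t. boundaries (sublevel C l t) d k)
      in \<lparr>
        pm_space = (\<lambda>t. {z +o B t | z. z \<in> Z t}),
        pm_zero = B,
        pm_add = (\<lambda>t X Y. X + Y),
        pm_scale = (\<lambda>t c X. s c ` X + B t),
        pm_map = (\<lambda>a b X. X + B b) \<rparr>)"

end

theory Submission
  imports Defs "HOL-Library.Function_Algebras"
begin

text \<open>
  Orthogonality makes the level \<open>t\<close> cycles the span of the \<open>x\<^sub>i\<close> with \<open>\<ell>(x\<^sub>i) \<le> t\<close>, and, since
  \<open>\<partial>y\<^sub>i = x\<^sub>i\<close> for \<open>i \<le> r\<close> and \<open>\<partial>y\<^sub>i = 0\<close> otherwise, the level \<open>t\<close> boundaries the span of the \<open>x\<^sub>i\<close>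
  with \<open>i \<le> r\<close> and \<open>\<ell>(y\<^sub>i) \<le> t\<close>. Both are coordinate subspaces for the same basis, so the quotient
  splits into interval modules, one for each \<open>x\<^sub>i\<close> that is not killed as soon as it is born.

  For uniqueness, the ranks of the structure maps count the intervals containing two given points.
  Removing points one at a time gives the number of intervals that contain a finite nonempty set
  and avoid another one, and such a pattern isolates any interval among finitely many others.
\<close>

section \<open>Isomorphisms of persistence modules\<close>

lemma pm_iso_trans:
  assumes "pm_iso P Q" "pm_iso Q R"
  shows "pm_iso P R"
proof -
  from assms(1) obtain f where
    f: "\<And>t. bij_betw (f t) (pm_space P t) (pm_space Q t)"
    "\<And>t u v. u \<in> pm_space P t \<Longrightarrow> v \<in> pm_space P t \<Longrightarrow> f t (pm_add P t u v) = pm_add Q t (f t u) (f t v)"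
    "\<And>t c u. u \<in> pm_space P t \<Longrightarrow> f t (pm_scale P t c u) = pm_scale Q t c (f t u)"
    "\<And>a b u. a \<le> b \<Longrightarrow> u \<in> pm_space P a \<Longrightarrow> f b (pm_map P a b u) = pm_map Q a b (f a u)"
    unfolding pm_iso_def by blast
  from assms(2) obtain g where
    g: "\<And>t. bij_betw (g t) (pm_space Q t) (pm_space R t)"
    "\<And>t u v. u \<in> pm_space Q t \<Longrightarrow> v \<in> pm_space Q t \<Longrightarrow> g t (pm_add Q t u v) = pm_add R t (g t u) (g t v)"
    "\<And>t c u. u \<in> pm_space Q t \<Longrightarrow> g t (pm_scale Q t c u) = pm_scale R t c (g t u)"
    "\<And>a b u. a \<le> b \<Longrightarrow> u \<in> pm_space Q a \<Longrightarrow> g b (pm_map Q a b u) = pm_map R a b (g a u)"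
    unfolding pm_iso_def by blast
  have fQ: "f t u \<in> pm_space Q t" if "u \<in> pm_space P t" for t u
    using f(1) that by (meson bij_betwE)
  show ?thesis
    unfolding pm_iso_def
    by (rule exI[of _ "\<lambda>t. g t \<circ> f t"]) (auto simp: f g fQ intro: bij_betw_trans[OF f(1) g(1)])
qed

text \<open>A persistence module is bare data here, so closure of \<open>P\<close> under its
  operations is a hypothesis: the inverse respects an operation because the result computed in
  \<open>P\<close> is again a point where \<open>inv_into\<close> undoes the isomorphism.\<close>

lemma pm_iso_sym:
  assumes "pm_iso P Q"
    and closed: "\<And>t u v. u \<in> pm_space P t \<Longrightarrow> v \<in> pm_space P t \<Longrightarrow> pm_add P t u v \<in> pm_space P t"
      "\<And>t c u. u \<in> pm_space P t \<Longrightarrow> pm_scale P t c u \<in> pm_space P t"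
      "\<And>a b u. a \<le> b \<Longrightarrow> u \<in> pm_space P a \<Longrightarrow> pm_map P a b u \<in> pm_space P b"
  shows "pm_iso Q P"
proof -
  from assms(1) obtain f where
    f: "\<And>t. bij_betw (f t) (pm_space P t) (pm_space Q t)"
    "\<And>t u v. u \<in> pm_space P t \<Longrightarrow> v \<in> pm_space P t \<Longrightarrow> f t (pm_add P t u v) = pm_add Q t (f t u) (f t v)"
    "\<And>t c u. u \<in> pm_space P t \<Longrightarrow> f t (pm_scale P t c u) = pm_scale Q t c (f t u)"
    "\<And>a b u. a \<le> b \<Longrightarrow> u \<in> pm_space P a \<Longrightarrow> f b (pm_map P a b u) = pm_map Q a b (f a u)"
    unfolding pm_iso_def by blast
  define g where "g = (\<lambda>t. inv_into (pm_space P t) (f t))"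
  have gf: "g t (f t u) = u" if "u \<in> pm_space P t" for t u
    using f(1) that unfolding g_def by (meson bij_betw_inv_into_left)
  have Q: "\<exists>v\<in>pm_space P t. u = f t v" if "u \<in> pm_space Q t" for t u
    using f(1)[of t] that by (auto simp: bij_betw_def)
  show ?thesis
    unfolding pm_iso_def
  proof (intro exI[of _ g] conjI allI ballI impI)
    fix t show "bij_betw (g t) (pm_space Q t) (pm_space P t)"
      using f(1) unfolding g_def by (rule bij_betw_inv_into)
  next
    fix t u v assume "u \<in> pm_space Q t" "v \<in> pm_space Q t"
    then obtain u' v' where "u' \<in> pm_space P t" "v' \<in> pm_space P t" "u = f t u'" "v = f t v'"
      using Q by meson
    then show "g t (pm_add Q t u v) = pm_add P t (g t u) (g t v)"
      using gf closed(1) f(2) by metis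
  next
    fix t c u assume "u \<in> pm_space Q t"
    then obtain u' where "u' \<in> pm_space P t" "u = f t u'"
      using Q by meson
    then show "g t (pm_scale Q t c u) = pm_scale P t c (g t u)"
      using gf closed(2) f(3) by metis
  next
    fix a b :: real and u assume "a \<le> b" "u \<in> pm_space Q a"
    moreover then obtain u' where "u' \<in> pm_space P a" "u = f a u'"
      using Q by meson
    ultimately show "g b (pm_map Q a b u) = pm_map P a b (g a u)"
      using gf closed(3) f(4) by metis
  qed
qed

section \<open>Direct sums of interval modules\<close>

abbreviation interval_sum :: "'i set \<Rightarrow> ('i \<Rightarrow> real set) \<Rightarrow> ('k::field, 'i \<Rightarrow> 'k) persistence_module" where
  "interval_sum A I \<equiv> pm_direct_sum A (\<lambda>i. interval_module (I i))"

lemma interval_sum_space: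
  "pm_space (interval_sum A I :: ('k::field, 'i \<Rightarrow> 'k) persistence_module) t =
     {f \<in> extensional A. (\<forall>i\<in>A. t \<notin> I i \<longrightarrow> f i = 0) \<and> finite {i \<in> A. f i \<noteq> 0}}"
  by (auto simp: pm_direct_sum_def interval_module_def PiE_def Pi_def split: if_splits)

lemma interval_sum_simps:
  "pm_add (interval_sum A I) t f g = (\<lambda>i\<in>A. f i + g i)"
  "pm_scale (interval_sum A I) t c f = (\<lambda>i\<in>A. c * f i)"
  "pm_map (interval_sum A I) a b f = (\<lambda>i\<in>A. if a \<in> I i \<and> b \<in> I i then f i else 0)"
  by (auto simp: pm_direct_sum_def interval_module_def)

text \<open>\<open>P\<close> is arbitrary data, so the closure conditions of
  \<open>pm_iso_sym\<close> are checked on the side of the interval sum, where the main point is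
  that supports stay finite.\<close>

lemma interval_sum_iso_sym:
  fixes A :: "'i set" and P :: "('k::field, 'a) persistence_module"
  assumes "pm_iso (interval_sum A I) P"
  shows "pm_iso P (interval_sum A I)"
proof (rule pm_iso_sym[OF assms])
  fix t and f g :: "'i \<Rightarrow> 'k"
  assume *: "f \<in> pm_space (interval_sum A I) t" "g \<in> pm_space (interval_sum A I) t"
  have "finite {i \<in> A. f i + g i \<noteq> 0}"
    by (rule finite_subset[of _ "{i \<in> A. f i \<noteq> 0} \<union> {i \<in> A. g i \<noteq> 0}"])
      (use * in \<open>auto simp: interval_sum_space\<close>)
  then show "pm_add (interval_sum A I) t f g \<in> pm_space (interval_sum A I) t"
    using * by (auto simp: interval_sum_space interval_sum_simps cong: conj_cong)
next
  fix t and c :: 'k and f :: "'i \<Rightarrow> 'k"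
  assume *: "f \<in> pm_space (interval_sum A I) t"
  have "finite {i \<in> A. c \<noteq> 0 \<and> f i \<noteq> 0}"
    by (rule finite_subset[of _ "{i \<in> A. f i \<noteq> 0}"]) (use * in \<open>auto simp: interval_sum_space\<close>)
  with * show "pm_scale (interval_sum A I) t c f \<in> pm_space (interval_sum A I) t"
    by (auto simp: interval_sum_space interval_sum_simps cong: conj_cong)
next
  fix a b and f :: "'i \<Rightarrow> 'k"
  assume *: "f \<in> pm_space (interval_sum A I) a"
  have "finite {i \<in> A. (\<lambda>i\<in>A. if a \<in> I i \<and> b \<in> I i then f i else 0) i \<noteq> 0}"
    by (rule finite_subset[of _ "{i \<in> A. f i \<noteq> 0}"]) (use * in \<open>auto simp: interval_sum_space\<close>)
  then show "pm_map (interval_sum A I) a b f \<in> pm_space (interval_sum A I) b"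
    unfolding interval_sum_space interval_sum_simps by simp
qed

section \<open>Independent families and the ranks of structure maps\<close>

lemma (in vector_space) independent_familyI:
  assumes "\<And>T c. finite T \<Longrightarrow> T \<subseteq> S \<Longrightarrow> (\<Sum>i\<in>T. scale (c i) (u i)) = 0 \<Longrightarrow> \<forall>i\<in>T. c i = 0"
  shows "inj_on u S \<and> independent (u ` S)"
proof
  show inj: "inj_on u S"
  proof (rule inj_onI, rule ccontr)
    \<comment> \<open>Two equal members at distinct indices satisfy the relation with coefficients 1
      and -1.\<close>
    fix i j assume *: "i \<in> S" "j \<in> S" "u i = u j" "i \<noteq> j"
    then show False
      using assms[of "{i, j}" "\<lambda>k. if k = i then 1 else - 1"] by auto
  qed
  show "independent (u ` S)"
    unfolding dependent_explicit
  proof clarify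
    fix t c v assume *: "finite t" "t \<subseteq> u ` S" "(\<Sum>v\<in>t. scale (c v) v) = 0" "v \<in> t" "c v \<noteq> 0"
    then obtain T where T: "T \<subseteq> S" "t = u ` T"
      by (auto simp: subset_image_iff)
    then have "inj_on u T" using inj inj_on_subset by blast
    with * T show False
      using assms[of T "c \<circ> u"] by (auto simp: sum.reindex dest: finite_imageD)
  qed
qed

text \<open>
  The unit vectors indexed by the intervals containing both \<open>a\<close> and \<open>b\<close> are in the image of the
  structure map, so an isomorphism sends them to independent vectors in the image on the other side.
\<close>

lemma interval_sum_rank_le:
  fixes A :: "'i set" and A' :: "'j set"
  assumes iso: "pm_iso (interval_sum A I :: ('k::field, _) persistence_module) (interval_sum A' I')"
    and ab: "a \<le> b" and fin: "finite {j \<in> A'. a \<in> I' j \<and> b \<in> I' j}"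
  shows "finite {i \<in> A. a \<in> I i \<and> b \<in> I i} \<and>
    card {i \<in> A. a \<in> I i \<and> b \<in> I i} \<le> card {j \<in> A'. a \<in> I' j \<and> b \<in> I' j}"
proof -
  let ?Q = "interval_sum A I :: ('k, _) persistence_module"
  let ?Q' = "interval_sum A' I' :: ('k, _) persistence_module"
  define S where "S = {i \<in> A. a \<in> I i \<and> b \<in> I i}"
  define S' where "S' = {j \<in> A'. a \<in> I' j \<and> b \<in> I' j}"
  obtain f where
    f: "\<And>t. bij_betw (f t) (pm_space ?Q t) (pm_space ?Q' t)"
    "\<And>t u v. u \<in> pm_space ?Q t \<Longrightarrow> v \<in> pm_space ?Q t \<Longrightarrow> f t (pm_add ?Q t u v) = pm_add ?Q' t (f t u) (f t v)"
    "\<And>t c u. u \<in> pm_space ?Q t \<Longrightarrow> f t (pm_scale ?Q t c u) = pm_scale ?Q' t c (f t u)"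
    "\<And>a b u. a \<le> b \<Longrightarrow> u \<in> pm_space ?Q a \<Longrightarrow> f b (pm_map ?Q a b u) = pm_map ?Q' a b (f a u)"
    using iso unfolding pm_iso_def by blast
  \<comment> \<open>The ambient space for the dimension count: all functions on the index type, with
    pointwise operations.\<close>
  interpret vs: vector_space "\<lambda>(c::'k) (g::'j \<Rightarrow> 'k) j. c * g j"
    by unfold_locales (auto simp: algebra_simps)
  \<comment> \<open>\<open>E c T\<close> is the combination of the unit vectors indexed by
    \<open>T\<close> with coefficients \<open>c\<close>; off \<open>A\<close> it is
    \<open>undefined\<close>, as extensionality demands.\<close>
  define E where "E = (\<lambda>(c::'i \<Rightarrow> 'k) T. \<lambda>i\<in>A. if i \<in> T then c i else 0)"
  have ESa: "E c T \<in> pm_space ?Q a" and ESb: "E c T \<in> pm_space ?Q b"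
    if "finite T" "T \<subseteq> S" for c T
  proof -
    have "finite {i \<in> A. E c T i \<noteq> 0}"
      using that(1) by (rule finite_subset[rotated]) (auto simp: E_def)
    moreover have "E c T \<in> extensional A" "\<And>i. i \<in> A - S \<Longrightarrow> E c T i = 0"
      using that(2) by (auto simp: E_def)
    ultimately show "E c T \<in> pm_space ?Q a" "E c T \<in> pm_space ?Q b"
      by (auto simp: interval_sum_space S_def)
  qed
  \<comment> \<open>For \<open>T\<close> inside \<open>S\<close> the structure map fixes
    \<open>E c T\<close>, so the image under \<open>f b\<close> comes from level \<open>a\<close>
    and vanishes at every index of \<open>A'\<close> outside \<open>S'\<close>.\<close>
  have fE_S': "f b (E c T) j = (if j \<in> S' then f b (E c T) j else 0)"
    if "finite T" "T \<subseteq> S" "j \<in> A'" for c T j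
  proof -
    have "pm_map ?Q a b (E c T) = E c T"
      using that by (auto simp: interval_sum_simps E_def S_def fun_eq_iff)
    then have "f b (E c T) = pm_map ?Q' a b (f a (E c T))"
      using f(4)[OF ab ESa[OF that(1,2)]] by metis
    then show ?thesis using that(3) by (simp add: interval_sum_simps S'_def)
  qed
  have f_space: "f b (E c T) \<in> pm_space ?Q' b" if "finite T" "T \<subseteq> S" for c T
    by (rule bij_betw_apply[OF f(1) ESb[OF that]])
  \<comment> \<open>Elements of the direct sum are \<open>undefined\<close> off \<open>A'\<close>,
    which is incompatible with pointwise operations. Cutting off to 0 outside \<open>S'\<close>
    makes the assignment linear and changes nothing on \<open>A'\<close>.\<close>
  define u where "u = (\<lambda>c T j. if j \<in> S' then f b (E c T) j else 0)"
  define e where "e = (\<lambda>i. u (\<lambda>_. 1) {i})"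
  have u_sum: "u c T = (\<Sum>i\<in>T. (\<lambda>j. c i * e i j))" if "finite T" "T \<subseteq> S" for c T
    using that
  proof (induction T)
    case empty
    \<comment> \<open>Preservation of zero is derived from compatibility with the scalar 0.\<close>
    have "E c {} = pm_scale ?Q b 0 (E c {})"
      by (auto simp: E_def interval_sum_simps)
    then have "f b (E c {}) = pm_scale ?Q' b 0 (f b (E c {}))"
      using f(3) ESb[of "{}"] by (metis empty_subsetI finite.emptyI)
    then have "f b (E c {}) j = 0" if "j \<in> A'" for j
      using that by (metis interval_sum_simps(2) mult_zero_left restrict_apply')
    then show ?case by (auto simp: u_def S'_def fun_eq_iff)
  next
    case (insert i T)
    let ?e = "E (\<lambda>_. 1) {i}"
    have "E c (insert i T) = pm_add ?Q b (pm_scale ?Q b (c i) ?e) (E c T)"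
      using insert.hyps by (auto simp: E_def interval_sum_simps fun_eq_iff)
    moreover have "pm_scale ?Q b (c i) ?e = E c {i}"
      by (auto simp: E_def interval_sum_simps fun_eq_iff)
    ultimately have "f b (E c (insert i T)) = pm_add ?Q' b (pm_scale ?Q' b (c i) (f b ?e)) (f b (E c T))"
      using f(2)[OF ESb[of "{i}" c] ESb[of T c]] f(3)[OF ESb[of "{i}" "\<lambda>_. 1"], of "c i"]
        insert.prems insert.hyps(1) by simp
    then have "u c (insert i T) = (\<lambda>j. c i * e i j) + u c T"
      by (auto simp: u_def e_def interval_sum_simps S'_def fun_eq_iff)
    then show ?case using insert by simp
  qed
  have "inj_on e S \<and> vs.independent (e ` S)"
  proof (rule vs.independent_familyI)
    fix T c assume T: "finite T" "T \<subseteq> S" "(\<Sum>i\<in>T. (\<lambda>j. c i * e i j)) = 0"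
    \<comment> \<open>A vanishing combination has the same image as the zero vector
      \<open>E c {}\<close>: both images are extensional and they agree on \<open>A'\<close>.
      Injectivity of \<open>f b\<close> then lets the coefficients be read off.\<close>
    have "f b (E c T) j = f b (E c {}) j" if "j \<in> A'" for j
      using u_sum[OF T(1,2), of c] u_sum[of "{}" c] T(3) fE_S'[OF T(1,2) that, of c]
        fE_S'[of "{}" j c] that by (auto simp: u_def fun_eq_iff split: if_splits)
    then have "f b (E c T) = f b (E c {})"
      using f_space[OF T(1,2), of c] f_space[of "{}" c]
      by (auto simp: interval_sum_space intro: extensionalityI)
    then have "E c T = E c {}"
      using f(1)[of b] ESb[OF T(1,2), of c] ESb[of "{}" c] by (auto simp: bij_betw_def inj_on_def)
    moreover have "E c T i = c i \<and> E c {} i = 0" if "i \<in> T" for i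
      using that T(2) by (auto simp: E_def S_def)
    ultimately show "\<forall>i\<in>T. c i = 0"
      by metis
  qed
  \<comment> \<open>Each \<open>e i\<close> is supported in \<open>S'\<close>, so the unit vectors
    indexed by \<open>S'\<close> span all of them and the exchange bound compares the
    cardinalities.\<close>
  moreover have "e ` S \<subseteq> vs.span ((\<lambda>j i. if i = j then 1 else 0) ` S')"
  proof clarify
    fix i assume "i \<in> S"
    have "e i = (\<Sum>j\<in>S'. (\<lambda>i'. e i j * (if i' = j then 1 else 0)))"
    proof
      fix j
      have "(\<Sum>j\<in>S'. (\<lambda>i'. e i j * (if i' = j then 1 else 0))) j
          = (\<Sum>j'\<in>S'. e i j' * (if j = j' then 1 else 0))"
        using fin unfolding S'_def[symmetric]
        by (induction S' rule: finite_induct) auto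
      also have "\<dots> = e i j"
        using fin unfolding S'_def[symmetric] by (auto simp: if_distrib e_def u_def cong: if_cong)
      finally show "e i j = (\<Sum>j\<in>S'. (\<lambda>i'. e i j * (if i' = j then 1 else 0))) j" ..
    qed
    also have "\<dots> \<in> vs.span ((\<lambda>j i. if i = j then 1 else 0) ` S')"
      by (intro vs.span_sum vs.span_scale vs.span_base) auto
    finally show "e i \<in> vs.span ((\<lambda>j i. if i = j then 1 else 0) ` S')" .
  qed
  ultimately have "finite (e ` S) \<and> card (e ` S) \<le> card ((\<lambda>j i. if i = j then 1 else (0::'k)) ` S')"
    using fin by (intro vs.independent_span_bound) (auto simp: S'_def)
  moreover have "card ((\<lambda>j i. if i = j then 1 else (0::'k)) ` S') \<le> card S'"
    using fin by (intro card_image_le) (auto simp: S'_def)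
  moreover note \<open>inj_on e S \<and> vs.independent (e ` S)\<close>
  ultimately show ?thesis
    unfolding S_def[symmetric] S'_def[symmetric]
    by (metis card_image finite_imageD le_trans)
qed

section \<open>Multiplicities are determined by ranks\<close>

text \<open>Induction on \<open>Y\<close>, with \<open>X\<close> arbitrary because points move from
  \<open>Y\<close> into \<open>X\<close>. When nothing is to be avoided, convexity reduces
  containing \<open>X\<close> to containing its least and greatest elements, which is what
  \<open>rank\<close> counts.\<close>

lemma separating_pattern_card_eq:
  fixes A :: "'i set" and A' :: "'j set" and I :: "'i \<Rightarrow> real set" and I' :: "'j \<Rightarrow> real set"
  assumes rank: "\<And>a b. a \<le> b \<Longrightarrow> card {i \<in> A. a \<in> I i \<and> b \<in> I i} = card {j \<in> A'. a \<in> I' j \<and> b \<in> I' j}"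
    and fin: "\<And>a. finite {i \<in> A. a \<in> I i}" "\<And>a. finite {j \<in> A'. a \<in> I' j}"
    and int: "\<And>i. i \<in> A \<Longrightarrow> is_interval (I i)" "\<And>j. j \<in> A' \<Longrightarrow> is_interval (I' j)"
    and "finite Y" "finite X" "X \<noteq> {}"
  shows "card {i \<in> A. X \<subseteq> I i \<and> Y \<inter> I i = {}} = card {j \<in> A'. X \<subseteq> I' j \<and> Y \<inter> I' j = {}}"
  using \<open>finite Y\<close> \<open>finite X\<close> \<open>X \<noteq> {}\<close>
proof (induction Y arbitrary: X)
  case empty
  have sub: "X \<subseteq> K \<longleftrightarrow> Min X \<in> K \<and> Max X \<in> K" if "is_interval K" for K
    using that empty unfolding is_interval_1 by (metis Max_ge Max_in Min_in Min_le subset_iff)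
  have "{i \<in> A. X \<subseteq> I i \<and> {} \<inter> I i = {}} = {i \<in> A. Min X \<in> I i \<and> Max X \<in> I i}"
    using sub[OF int(1)] by auto
  moreover have "{j \<in> A'. X \<subseteq> I' j \<and> {} \<inter> I' j = {}} = {j \<in> A'. Min X \<in> I' j \<and> Max X \<in> I' j}"
    using sub[OF int(2)] by auto
  moreover have "Min X \<le> Max X" using empty by simp
  ultimately show ?case using rank by simp
next
  case (insert y Y)
  \<comment> \<open>The members that avoid \<open>y\<close> are all members minus those that contain
    it, so the induction hypothesis is used for \<open>X\<close> and for \<open>insert y X\<close>.
    Finiteness makes the subtraction of cardinalities legitimate.\<close>
  have split: "card {i \<in> B. X \<subseteq> K i \<and> insert y Y \<inter> K i = {}} =
      card {i \<in> B. X \<subseteq> K i \<and> Y \<inter> K i = {}} - card {i \<in> B. insert y X \<subseteq> K i \<and> Y \<inter> K i = {}}"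
    if "\<And>a. finite {i \<in> B. a \<in> K i}" for B :: "'b set" and K :: "'b \<Rightarrow> real set"
  proof -
    have "{i \<in> B. X \<subseteq> K i \<and> insert y Y \<inter> K i = {}} =
        {i \<in> B. X \<subseteq> K i \<and> Y \<inter> K i = {}} - {i \<in> B. insert y X \<subseteq> K i \<and> Y \<inter> K i = {}}"
      by auto
    moreover have "finite {i \<in> B. insert y X \<subseteq> K i \<and> Y \<inter> K i = {}}"
      by (rule finite_subset[OF _ that[of y]]) auto
    ultimately show ?thesis by (simp add: card_Diff_subset subset_eq)
  qed
  show ?case
    unfolding split[OF fin(1)] split[OF fin(2)]
    using insert.IH[of X] insert.IH[of "insert y X"] insert.prems by simp
qed

text \<open>Only \<mu> is assumed to have finite support, so a finite pattern can isolate
  \<open>I\<close> among the intervals of \<mu> but perhaps not among those of \<mu>'. Copies of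
  \<open>I\<close> in \<mu>' are therefore only some of the members counted, which yields an
  inequality.\<close>

lemma multiplicity_le:
  fixes \<mu> \<mu>' :: "real set \<Rightarrow> nat"
  defines "A \<equiv> {(I, j). j < \<mu> I}" and "A' \<equiv> {(I, j). j < \<mu>' I}"
  assumes rank: "\<And>a b. a \<le> b \<Longrightarrow>
      card {i \<in> A. a \<in> fst i \<and> b \<in> fst i} = card {i \<in> A'. a \<in> fst i \<and> b \<in> fst i}"
    and fin: "\<And>a. finite {i \<in> A. a \<in> fst i}" "\<And>a. finite {i \<in> A'. a \<in> fst i}"
    and int: "\<And>I. \<mu> I \<noteq> 0 \<Longrightarrow> is_interval I" "\<And>I. \<mu>' I \<noteq> 0 \<Longrightarrow> is_interval I \<and> I \<noteq> {}"
    and supp: "finite {I. \<mu> I \<noteq> 0}"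
  shows "\<mu>' I \<le> \<mu> I"
proof (cases "\<mu>' I = 0")
  case False
  then obtain p where p: "p \<in> I" using int(2) by blast
  define D where "D = {J. \<mu> J \<noteq> 0 \<and> J \<noteq> I}"
  \<comment> \<open>Each competing interval differs from \<open>I\<close> at some point
    \<open>q J\<close>, which is to be contained or avoided according to its membership in
    \<open>I\<close>.\<close>
  have "\<exists>q. (q \<in> I) \<noteq> (q \<in> J)" if "J \<in> D" for J
    using that unfolding D_def by blast
  then obtain q where q: "\<And>J. J \<in> D \<Longrightarrow> (q J \<in> I) \<noteq> (q J \<in> J)" by metis
  have "finite D" using supp unfolding D_def by (rule finite_subset[rotated]) auto
  \<comment> \<open>The point \<open>p\<close> keeps \<open>X\<close> nonempty even if no chosen
    point lies in \<open>I\<close>.\<close>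
  define X where "X = insert p (q ` D \<inter> I)"
  define Y where "Y = q ` D - I"
  have XY: "finite X" "X \<noteq> {}" "finite Y" "X \<subseteq> I" "Y \<inter> I = {}"
    using \<open>finite D\<close> p by (auto simp: X_def Y_def)
  have sep: "J = I" if J: "\<mu> J \<noteq> 0" "X \<subseteq> J" "Y \<inter> J = {}" for J
  proof (rule ccontr)
    assume "J \<noteq> I"
    then have "J \<in> D" using J by (simp add: D_def)
    then show False using q[of J] J by (auto simp: X_def Y_def)
  qed
  have "\<mu>' I = card (Pair I ` {..<\<mu>' I})" by (simp add: card_image inj_on_def)
  also have "\<dots> \<le> card {i \<in> A'. X \<subseteq> fst i \<and> Y \<inter> fst i = {}}"
  proof (rule card_mono)
    show "finite {i \<in> A'. X \<subseteq> fst i \<and> Y \<inter> fst i = {}}"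
      by (rule finite_subset[OF _ fin(2)[of p]]) (auto simp: X_def)
  qed (use XY in \<open>auto simp: A'_def\<close>)
  also have "\<dots> = card {i \<in> A. X \<subseteq> fst i \<and> Y \<inter> fst i = {}}"
    using int by (intro separating_pattern_card_eq[symmetric] rank fin XY) (auto simp: A_def A'_def)
  also have "\<dots> \<le> card (Pair I ` {..<\<mu> I})"
  proof (rule card_mono)
    show "{i \<in> A. X \<subseteq> fst i \<and> Y \<inter> fst i = {}} \<subseteq> Pair I ` {..<\<mu> I}"
    proof clarify
      fix J j assume *: "(J, j) \<in> A" "X \<subseteq> fst (J, j)" "Y \<inter> fst (J, j) = {}"
      then have "J = I" by (intro sep) (auto simp: A_def)
      with * show "(J, j) \<in> Pair I ` {..<\<mu> I}" by (simp add: A_def)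
    qed
  qed simp
  also have "\<dots> = \<mu> I" by (simp add: card_image inj_on_def)
  finally show ?thesis .
qed simp

section \<open>Quotients of filtered coordinate subspaces\<close>

context vector_space
begin

lemma coset_eq_iff:
  assumes "subspace B"
  shows "z +o B = z' +o B \<longleftrightarrow> z - z' \<in> B"
proof
  assume *: "z +o B = z' +o B"
  have "z + 0 \<in> z +o B" using assms by (intro set_plus_intro2 subspace_0)
  then show "z - z' \<in> B" unfolding * by (auto simp: elt_set_plus_def)
next
  assume *: "z - z' \<in> B"
  have "z + b \<in> z' +o B" "z' + b \<in> z +o B" if "b \<in> B" for b
    using set_plus_intro2[OF subspace_add[OF assms * that], of z']
      set_plus_intro2[OF subspace_diff[OF assms that *], of z] by (auto simp: algebra_simps)
  then show "z +o B = z' +o B" unfolding elt_set_plus_def by blast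
qed

lemma subspace_plus_absorb:
  assumes "subspace B'" "0 \<in> B" "B \<subseteq> B'"
  shows "B + B' = B'"
  using assms by (auto simp: set_plus_def subspace_add) (metis add_0)

lemma coset_plus_subspace:
  assumes "subspace B" "subspace B'" "B \<subseteq> B'"
  shows "(z +o B) + B' = z +o B'"
  using assms by (simp add: set_plus_rearrange3 subspace_plus_absorb subspace_0)

lemma coset_plus_coset:
  assumes "subspace B"
  shows "(z +o B) + (z' +o B) = (z + z') +o B"
  using assms by (simp add: set_plus_rearrange subspace_plus_absorb subspace_0)

lemma scale_coset_plus:
  assumes "subspace B"
  shows "scale c ` (z +o B) + B = scale c z +o B"
proof -
  have "scale c ` (z +o B) = scale c z +o (scale c ` B)"
    unfolding elt_set_plus_def image_def by (auto simp: scale_right_distrib)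
  moreover have "scale c ` B + B = B"
    using assms by (intro subspace_plus_absorb) (auto simp: subspace_scale subspace_0 image_iff intro!: bexI[of _ 0])
  ultimately show ?thesis by (simp add: set_plus_rearrange3)
qed

text \<open>The classes of the \<open>x i\<close> with \<open>i\<close> in \<open>S t - T t\<close>
  form a basis of the quotient at level \<open>t\<close>, so each index contributes the interval
  module of those levels. The isomorphism sends coefficients to the coset of their combination
  \<open>L f\<close>. The index set \<open>A\<close> is abstract so that it can consist of pairs of
  an interval and a copy number; \<sigma> matches it with the indices that are alive at some
  level.\<close>

lemma interval_sum_iso_quotient:
  fixes x :: "'i \<Rightarrow> 'b" and S T :: "real \<Rightarrow> 'i set" and A :: "'j set"
  assumes E: "finite E" "inj_on x E" "independent (x ` E)"
    and TS: "\<And>t. T t \<subseteq> S t" "\<And>t. S t \<subseteq> E"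
    and mono: "\<And>a b. a \<le> b \<Longrightarrow> S a \<subseteq> S b" "\<And>a b. a \<le> b \<Longrightarrow> T a \<subseteq> T b"
    and \<sigma>: "bij_betw \<sigma> A {i \<in> E. {t. i \<in> S t - T t} \<noteq> {}}"
    and I: "\<And>j. j \<in> A \<Longrightarrow> I j = {t. \<sigma> j \<in> S t - T t}"
    and Z: "\<And>t. Z t = span (x ` S t)" and B: "\<And>t. B t = span (x ` T t)"
  shows "pm_iso (interval_sum A I)
     \<lparr>pm_space = (\<lambda>t. {z +o B t | z. z \<in> Z t}), pm_zero = B,
      pm_add = (\<lambda>t X Y. X + Y), pm_scale = (\<lambda>t c X. scale c ` X + B t),
      pm_map = (\<lambda>a b X. X + B b)\<rparr>"
proof -
  have subB: "subspace (B t)" for t by (simp add: B)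
  have finA: "finite A"
    using E(1) \<sigma> by (simp add: bij_betw_finite)
  have \<sigma>E: "\<sigma> j \<in> E" if "j \<in> A" for j using \<sigma> that bij_betwE by fastforce
  define L where "L = (\<lambda>f. \<Sum>j\<in>A. scale (f j) (x (\<sigma> j)))"
  have L_diff: "L f - L g = L (\<lambda>j. f j - g j)" for f g
    by (simp add: L_def sum_subtractf scale_left_diff_distrib)
  have coord: "f j = 0" if "L f \<in> span (x ` T t)" "j \<in> A" "\<sigma> j \<notin> T t" for f j t
  proof -
    let ?R = "representation (x ` E)"
    have TE: "T t \<subseteq> E" using TS by blast
    have "?R (L f) (x (\<sigma> j)) = (\<Sum>i\<in>A. f i * ?R (x (\<sigma> i)) (x (\<sigma> j)))"
      using E(3) \<sigma>E by (simp add: L_def representation_sum representation_scale span_base span_scale)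
    also have "\<dots> = (\<Sum>i\<in>A. if i = j then f i else 0)"
    proof (rule sum.cong)
      fix i assume i: "i \<in> A"
      have "x (\<sigma> i) = x (\<sigma> j) \<longleftrightarrow> i = j"
        using inj_on_eq_iff[OF E(2) \<sigma>E[OF i] \<sigma>E[OF that(2)]]
          inj_on_eq_iff[OF bij_betw_imp_inj_on[OF \<sigma>] i that(2)] by simp
      then show "f i * ?R (x (\<sigma> i)) (x (\<sigma> j)) = (if i = j then f i else 0)"
        using representation_basis[OF E(3), of "x (\<sigma> i)"] \<sigma>E[OF i] by auto
    qed simp
    also have "\<dots> = f j" using finA that(2) by simp
    also have "?R (L f) = representation (x ` T t) (L f)"
      using E(3) that(1) TE by (intro representation_extend) auto
    finally have "representation (x ` T t) (L f) (x (\<sigma> j)) = f j" .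
    moreover have "x (\<sigma> j) \<notin> x ` T t"
      using that(2,3) \<sigma>E E(2) TE by (auto dest: inj_onD)
    ultimately show ?thesis using representation_ne_zero by metis
  qed
  have LZ: "L f \<in> Z t" if "\<And>j. j \<in> A \<Longrightarrow> t \<notin> I j \<Longrightarrow> f j = 0" for f t
    unfolding L_def Z
  proof (rule span_sum)
    fix j assume "j \<in> A"
    then show "scale (f j) (x (\<sigma> j)) \<in> span (x ` S t)"
      using that[of j] I[of j] by (cases "t \<in> I j") (auto intro: span_scale span_base span_zero)
  qed
  show ?thesis
    unfolding pm_iso_def
  proof (intro exI[of _ "\<lambda>t f. L f +o B t"] conjI allI ballI impI; (unfold persistence_module.simps)?)
    fix t
    show "bij_betw (\<lambda>f. L f +o B t) (pm_space (interval_sum A I) t) {z +o B t |z. z \<in> Z t}"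
    proof (rule bij_betw_imageI)
      show "inj_on (\<lambda>f. L f +o B t) (pm_space (interval_sum A I) t)"
      proof (rule inj_onI)
        fix f g assume f: "f \<in> pm_space (interval_sum A I) t" and g: "g \<in> pm_space (interval_sum A I) t"
          and "L f +o B t = L g +o B t"
        then have *: "L (\<lambda>j. f j - g j) \<in> span (x ` T t)"
          by (simp add: coset_eq_iff subB L_diff flip: B)
        \<comment> \<open>Outside \<open>T t\<close> the difference has zero coordinates by
          \<open>coord\<close>; inside \<open>T t\<close> the level \<open>t\<close> is not in
          \<open>I j\<close> and both functions vanish.\<close>
        have "f j = g j" if "j \<in> A" for j
          using coord[OF * that] f g that I[OF that]
          by (cases "\<sigma> j \<in> T t") (auto simp: interval_sum_space)
        then show "f = g"
          using f g by (auto simp: interval_sum_space intro: extensionalityI)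
      qed
      show "(\<lambda>f. L f +o B t) ` pm_space (interval_sum A I) t = {z +o B t |z. z \<in> Z t}"
      proof (intro equalityI subsetI)
        fix X assume "X \<in> (\<lambda>f. L f +o B t) ` pm_space (interval_sum A I) t"
        then show "X \<in> {z +o B t |z. z \<in> Z t}"
          using LZ by (auto simp: interval_sum_space)
      next
        fix X assume "X \<in> {z +o B t |z. z \<in> Z t}"
        then obtain z where z: "X = z +o B t" "z \<in> span (x ` S t)" by (auto simp: Z)
        let ?c = "\<lambda>i. representation (x ` S t) z (x i)"
        \<comment> \<open>A preimage of the class of \<open>z\<close> keeps the coordinates at
          \<open>S t - T t\<close>; the discarded ones make up an element of
          \<open>B t\<close>.\<close>
        define f where "f = (\<lambda>j\<in>A. if t \<in> I j then ?c (\<sigma> j) else 0)"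
        have injS: "inj_on x (S t)" and finS: "finite (S t)"
          using E TS(2) by (auto intro: inj_on_subset finite_subset)
        have "bij_betw \<sigma> {j \<in> A. t \<in> I j} (S t - T t)"
          unfolding bij_betw_def
        proof
          show "inj_on \<sigma> {j \<in> A. t \<in> I j}"
            using \<sigma> by (auto simp: bij_betw_def intro: inj_on_subset)
          have "S t - T t \<subseteq> \<sigma> ` A"
            using \<sigma> TS(2)[of t] by (auto simp: bij_betw_def)
          then show "\<sigma> ` {j \<in> A. t \<in> I j} = S t - T t"
            using I by auto
        qed
        then have reindex: "(\<Sum>j | j \<in> A \<and> t \<in> I j. scale (?c (\<sigma> j)) (x (\<sigma> j))) = (\<Sum>i\<in>S t - T t. scale (?c i) (x i))"
          by (rule sum.reindex_bij_betw)
        have Lf: "L f = (\<Sum>i\<in>S t - T t. scale (?c i) (x i))"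
          unfolding reindex[symmetric]
          unfolding L_def using finA by (intro sum.mono_neutral_cong_right) (auto simp: f_def)
        have zS: "z = (\<Sum>i\<in>S t. scale (?c i) (x i))"
        proof -
          have "independent (x ` S t)"
            using E(3) TS(2) by (meson image_mono independent_mono)
          then have "z = (\<Sum>v\<in>x ` S t. scale (representation (x ` S t) z v) v)"
            using finS z(2) by (simp add: sum_representation_eq)
          then show ?thesis using injS by (simp add: sum.reindex)
        qed
        have "(\<Sum>i\<in>T t. scale (?c i) (x i)) + L f = z"
          unfolding Lf
          by (subst add.commute, rule trans[OF sum.subset_diff[OF TS(1) finS, symmetric] zS[symmetric]])
        then have "z - L f = (\<Sum>i\<in>T t. scale (?c i) (x i))"
          by (rule add_implies_diff[symmetric])
        also have "\<dots> \<in> B t"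
          unfolding B by (intro span_sum span_scale span_base) auto
        finally have "X = L f +o B t" by (simp add: z coset_eq_iff subB)
        moreover have "f \<in> pm_space (interval_sum A I) t"
          using finA by (auto simp: interval_sum_space f_def)
        ultimately show "X \<in> (\<lambda>f. L f +o B t) ` pm_space (interval_sum A I) t" by blast
      qed
    qed
  next
    fix t and f g :: "'j \<Rightarrow> 'a"
    have "L (pm_add (interval_sum A I) t f g) = L f + L g"
      unfolding L_def interval_sum_simps sum.distrib[symmetric]
      by (rule sum.cong) (auto simp: scale_left_distrib)
    then show "L (pm_add (interval_sum A I) t f g) +o B t = (L f +o B t) + (L g +o B t)"
      by (simp add: coset_plus_coset subB)
  next
    fix t c and f :: "'j \<Rightarrow> 'a"
    have "L (pm_scale (interval_sum A I) t c f) = scale c (L f)"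
      by (auto simp: L_def interval_sum_simps scale_sum_right intro!: sum.cong)
    then show "L (pm_scale (interval_sum A I) t c f) +o B t = scale c ` (L f +o B t) + B t"
      by (simp add: scale_coset_plus subB)
  next
    fix a b :: real and f :: "'j \<Rightarrow> 'a"
    assume ab: "a \<le> b" and f: "f \<in> pm_space (interval_sum A I) a"
    let ?f = "pm_map (interval_sum A I) a b f"
    \<comment> \<open>The structure map deletes only coordinates alive at \<open>a\<close> but not
      at \<open>b\<close>. Since \<open>S\<close> grows, such an index has entered
      \<open>T b\<close>, so the deleted part is a boundary at level \<open>b\<close>.\<close>
    have "L f - L ?f \<in> B b"
      unfolding L_diff unfolding L_def B
    proof (rule span_sum)
      fix j assume j: "j \<in> A"
      show "scale (f j - ?f j) (x (\<sigma> j)) \<in> span (x ` T b)"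
      proof (cases "f j - ?f j = 0")
        case False
        then have "a \<in> I j" "b \<notin> I j"
          using f j by (auto simp: interval_sum_space interval_sum_simps split: if_splits)
        then have "\<sigma> j \<in> T b" using I[OF j] mono(1)[OF ab] by auto
        then show ?thesis by (intro span_scale span_base) auto
      qed (simp add: span_zero)
    qed
    then have "L f +o B b = L ?f +o B b" by (simp add: coset_eq_iff subB)
    moreover have "B a \<subseteq> B b" unfolding B using mono(2)[OF ab] by (intro span_mono image_mono)
    ultimately show "L ?f +o B b = (L f +o B a) + B b"
      by (simp add: coset_plus_subspace subB)
  qed
qed

end

section \<open>Uniqueness of interval decompositions\<close>

text \<open>The hypothesis \<open>iso\<close> points towards \<open>P\<close>, so it composes with
  the isomorphism out of \<open>P\<close> given by \<mu>'. Inversion is then applied only between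
  interval sums, where closure is known.\<close>

lemma interval_decomposition_unique:
  fixes P :: "('k::field, 'a) persistence_module" and \<mu> \<mu>' :: "real set \<Rightarrow> nat"
  assumes iso: "pm_iso (interval_sum {(I, j). j < \<mu> I} fst) P"
    and int: "\<And>I. \<mu> I \<noteq> 0 \<Longrightarrow> is_interval I \<and> I \<noteq> {}"
    and supp: "finite {I. \<mu> I \<noteq> 0}"
    and \<mu>': "interval_decomposition P \<mu>'"
  shows "\<mu>' = \<mu>"
proof -
  define A where "A = {(I, j). j < \<mu> I}"
  define A' where "A' = {(I, j). j < \<mu>' I}"
  have "(\<lambda>(I, j :: nat). interval_module I :: ('k, 'k) persistence_module) = (\<lambda>i. interval_module (fst i))"
    by auto
  then have "pm_iso P (interval_sum A' fst)"
    using \<mu>' by (simp add: interval_decomposition_def A'_def)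
  then have QQ': "pm_iso (interval_sum A fst :: ('k, _) persistence_module) (interval_sum A' fst)"
    using iso pm_iso_trans by (auto simp: A_def)
  then have Q'Q: "pm_iso (interval_sum A' fst :: ('k, _) persistence_module) (interval_sum A fst)"
    by (rule interval_sum_iso_sym)
  have int': "\<And>I. \<mu>' I \<noteq> 0 \<Longrightarrow> is_interval I \<and> I \<noteq> {}"
    using \<mu>' by (simp add: interval_decomposition_def)
  have "A = (SIGMA I:{I. \<mu> I \<noteq> 0}. {..<\<mu> I})" by (auto simp: A_def)
  then have "finite A" using supp by auto
  then have fin: "finite {i \<in> A. a \<in> fst i \<and> b \<in> fst i}" for a b by simp
  \<comment> \<open>Finiteness of the counts is transported from \<open>A\<close> to
    \<open>A'\<close> first; the reverse rank inequality can be applied only afterwards.\<close>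
  note le' = interval_sum_rank_le[OF Q'Q _ fin]
  have fin': "finite {i \<in> A'. a \<in> fst i \<and> b \<in> fst i}" if "a \<le> b" for a b
    using le'[OF that] by blast
  have rank: "card {i \<in> A. a \<in> fst i \<and> b \<in> fst i} = card {i \<in> A'. a \<in> fst i \<and> b \<in> fst i}"
    if "a \<le> b" for a b
    using le'[OF that] interval_sum_rank_le[OF QQ' that fin'[OF that]] by (auto intro: antisym)
  have fin1: "finite {i \<in> A. a \<in> fst i}" "finite {i \<in> A'. a \<in> fst i}" for a
    using fin[of a a] fin'[of a a] by auto
  have le: "\<mu>' I \<le> \<mu> I" for I
    using rank fin1 int int' supp unfolding A_def A'_def by (intro multiplicity_le) auto
  \<comment> \<open>The first inequality bounds the support of \<mu>', which permits
    \<open>multiplicity_le\<close> with the roles exchanged.\<close>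
  have "finite {I. \<mu>' I \<noteq> 0}"
    using le by (intro finite_subset[OF _ supp] Collect_mono) (metis le_zero_eq)
  then have "\<mu> I \<le> \<mu>' I" for I
    using rank[symmetric] fin1 int int' unfolding A_def A'_def by (intro multiplicity_le) auto
  with le show ?thesis by (auto intro: antisym)
qed

text \<open>Links the two ways of indexing summands, by interval and copy number or by basis index:
  enumerate every fiber of \<open>g\<close> separately.\<close>

lemma fiber_index_bij:
  assumes "finite J"
  obtains \<sigma> where "bij_betw \<sigma> {(I, j). j < card {i \<in> J. g i = I}} J"
    and "\<And>p. p \<in> {(I, j). j < card {i \<in> J. g i = I}} \<Longrightarrow> g (\<sigma> p) = fst p"
proof -
  have "\<exists>h. bij_betw h {0..<card {i \<in> J. g i = I}} {i \<in> J. g i = I}" for I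
    using assms by (intro ex_bij_betw_nat_finite) simp
  then obtain h where h: "\<And>I. bij_betw (h I) {0..<card {i \<in> J. g i = I}} {i \<in> J. g i = I}"
    by metis
  have hin: "h I j \<in> J \<and> g (h I j) = I" if "j < card {i \<in> J. g i = I}" for I j
    using bij_betw_apply[OF h, of j I] that by auto
  have "bij_betw (\<lambda>(I, j). h I j) {(I, j). j < card {i \<in> J. g i = I}} J"
  proof (rule bij_betw_imageI)
    show "inj_on (\<lambda>(I, j). h I j) {(I, j). j < card {i \<in> J. g i = I}}"
    proof (rule inj_onI, clarify)
      fix I j I' j' assume *: "j < card {i \<in> J. g i = I}" "j' < card {i \<in> J. g i = I'}" "h I j = h I' j'"
      then have "I = I'" using hin by metis
      with * show "I = I' \<and> j = j'"
        using bij_betw_imp_inj_on[OF h[of I]] by (auto dest: inj_onD)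
    qed
    have "i \<in> (\<lambda>(I, j). h I j) ` {(I, j). j < card {i \<in> J. g i = I}}" if "i \<in> J" for i
    proof -
      have "i \<in> h (g i) ` {0..<card {i' \<in> J. g i' = g i}}"
        using bij_betw_imp_surj_on[OF h[of "g i"]] that by simp
      then show ?thesis by force
    qed
    then show "(\<lambda>(I, j). h I j) ` {(I, j). j < card {i \<in> J. g i = I}} = J"
      using hin by auto
  qed
  moreover have "g ((\<lambda>(I, j). h I j) p) = fst p" if "p \<in> {(I, j). j < card {i \<in> J. g i = I}}" for p
    using that hin by auto
  ultimately show thesis by (rule that)
qed

section \<open>Sublevel sets in orthogonal bases\<close>

context vector_space
begin

lemma span_family:
  assumes "finite J" "inj_on w J"
  shows "span (w ` J) = range (\<lambda>c. \<Sum>i\<in>J. scale (c i) (w i))"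
proof
  show "span (w ` J) \<subseteq> range (\<lambda>c. \<Sum>i\<in>J. scale (c i) (w i))"
  proof
    fix v assume "v \<in> span (w ` J)"
    then obtain c where "v = (\<Sum>b\<in>w ` J. scale (c b) b)"
      using assms(1) by (auto simp: span_finite)
    then have "v = (\<Sum>i\<in>J. scale ((c \<circ> w) i) (w i))"
      using assms(2) by (simp add: sum.reindex)
    then show "v \<in> range (\<lambda>c. \<Sum>i\<in>J. scale (c i) (w i))" by blast
  qed
  show "range (\<lambda>c. \<Sum>i\<in>J. scale (c i) (w i)) \<subseteq> span (w ` J)"
    by (intro image_subsetI span_sum span_scale span_base imageI)
qed

text \<open>Nonzero scalars do not change \<open>l\<close> under the trivial valuation, so by
  orthogonality the level of a combination is the largest \<open>l (w i)\<close> with nonzero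
  coefficient. The separate ambient \<open>U\<close> lets the axioms for a chain space serve its
  space of cycles.\<close>

lemma orthogonal_basis_sublevel:
  assumes U: "orthogonalizable scale l U" and V: "V \<subseteq> U" and w: "orthogonal_basis scale l V J w"
  shows "{v \<in> V. l v \<le> ereal t} = span (w ` {i \<in> J. l (w i) \<le> ereal t})"
proof -
  have J: "finite J" "inj_on w J" "span (w ` J) = V" "orthogonal_family scale l J w"
    using w by (auto simp: orthogonal_basis_def basis_family_def)
  have le_iff: "l (\<Sum>i\<in>J. scale (c i) (w i)) \<le> ereal t \<longleftrightarrow> (\<forall>i\<in>J. c i \<noteq> 0 \<longrightarrow> l (w i) \<le> ereal t)" for c
  proof -
    have "l (scale (c i) (w i)) \<le> ereal t \<longleftrightarrow> (c i \<noteq> 0 \<longrightarrow> l (w i) \<le> ereal t)" if "i \<in> J" for i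
    proof -
      \<comment> \<open>Excluding the value \<infinity> matters for a zero coefficient: the scaled
        vector then has level \<open>l (w i) - \<infinity>\<close>, which must be
        \<open>-\<infinity>\<close>.\<close>
      have "w i \<in> U" using J(3) V that span_base by blast
      then have "l (w i) \<noteq> \<infinity>" "l (scale (c i) (w i)) = l (w i) - trivial_valuation (c i)"
        using U by (auto simp: orthogonalizable_def)
      then show ?thesis by (cases "l (w i)") (auto simp: trivial_valuation_def)
    qed
    then show ?thesis
      using J(4) by (auto simp: orthogonal_family_def SUP_le_iff)
  qed
  let ?J = "{i \<in> J. l (w i) \<le> ereal t}"
  show ?thesis
  proof (intro equalityI subsetI)
    fix v assume v: "v \<in> {v \<in> V. l v \<le> ereal t}"
    then obtain c where c: "v = (\<Sum>i\<in>J. scale (c i) (w i))"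
      using span_family[OF J(1,2)] J(3) by auto
    have "scale (c i) (w i) \<in> span (w ` ?J)" if "i \<in> J" for i
      using v that le_iff[of c] unfolding c
      by (cases "c i = 0") (auto intro: span_zero span_scale span_base)
    then show "v \<in> span (w ` ?J)" unfolding c by (rule span_sum)
  next
    fix v assume v: "v \<in> span (w ` ?J)"
    have "inj_on w ?J" using J(2) by (auto intro: inj_on_subset)
    then obtain c where "v = (\<Sum>i\<in>?J. scale (c i) (w i))"
      using span_family[of ?J w] J(1) v by auto
    also have "\<dots> = (\<Sum>i\<in>J. scale (if i \<in> ?J then c i else 0) (w i))"
      using J(1) by (intro sum.mono_neutral_cong_left) auto
    finally have "l v \<le> ereal t" by (simp only: le_iff) auto
    moreover have "v \<in> V" using v span_mono[of "w ` ?J" "w ` J"] J(3) by auto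
    ultimately show "v \<in> {v \<in> V. l v \<le> ereal t}" by simp
  qed
qed

lemma basis_family_card_le:
  assumes "basis_family scale V J v" "basis_family scale W K w" "V \<subseteq> W"
  shows "card J \<le> card K"
proof -
  have "card (v ` J) \<le> card (w ` K)"
    using assms span_superset[of "v ` J"] independent_span_bound[of "w ` K" "v ` J"]
    by (auto simp: basis_family_def)
  then show ?thesis using assms by (simp add: basis_family_def card_image)
qed

end

section \<open>The barcode read off from the singular value decomposition\<close>

theorem theorem6p2:
  fixes s :: "'k::field \<Rightarrow> 'v::ab_group_add \<Rightarrow> 'v"
    and C :: "int \<Rightarrow> 'v set" and d :: "'v \<Rightarrow> 'v" and l :: "'v \<Rightarrow> ereal"
    and k :: int and n m r :: nat and y x :: "nat \<Rightarrow> 'v"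
  assumes "floer_type_complex s C d l"
    and "singular_value_decomposition s l (C (k + 1)) s l (cycles C d k) d n y m x"
    and "r = vector_space.dim s (d ` C (k + 1))"
  shows "is_barcode (persistent_homology s C d l k)
           (count
             ({# {t. l (x i) \<le> ereal t \<and> ereal t < l (y i)}. i \<in># mset_set {i \<in> {1..r}. l (x i) < l (y i)} #}
              + {# {t. l (x i) \<le> ereal t}. i \<in># mset_set {r+1..m} #}))"
proof -
  interpret floer_type_complex s C d l by fact
  interpret d: Vector_Spaces.linear s s d by (rule linear_d)
  have y: "orthogonal_basis s l (C (k + 1)) {1..n} y"
    and x: "orthogonal_basis s l (cycles C d k) {1..m} x"
    and y_ker: "orthogonal_basis s l {v \<in> C (k + 1). d v = 0} {r+1..n} y"
    and x_im: "orthogonal_basis s l (d ` C (k + 1)) {1..r} x"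
    and dy: "\<And>i. i \<in> {1..r} \<Longrightarrow> d (y i) = x i"
    using assms(2,3) unfolding singular_value_decomposition_def Let_def by blast+
  have im_cycles: "d ` C (k + 1) \<subseteq> cycles C d k"
    using degree_d[of "k + 1"] d_d by (auto simp: cycles_def)
  have cycles_C: "cycles C d k \<subseteq> C k" by (auto simp: cycles_def)
  have rm: "r \<le> m"
    using basis_family_card_le[of _ "{1..r}" x _ "{1..m}" x] x x_im im_cycles
    by (auto simp: orthogonal_basis_def)
  \<comment> \<open>The images of the \<open>n\<close> basis vectors span a space containing the
    \<open>r\<close> independent vectors \<open>x i\<close>. The bound places \<open>y i\<close> in
    \<open>C (k + 1)\<close> for every \<open>i\<close> up to \<open>r\<close>.\<close>
  have rn: "r \<le> n"
  proof -
    have span: "span (y ` {1..n}) = C (k + 1)" "span (x ` {1..r}) = d ` C (k + 1)"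
      and x_ind: "independent (x ` {1..r})" "inj_on x {1..r}"
      using y x_im by (auto simp: orthogonal_basis_def basis_family_def)
    have "x ` {1..r} \<subseteq> span (d ` y ` {1..n})"
      using span span_superset[of "x ` {1..r}"] d.span_image by metis
    then have "card (x ` {1..r}) \<le> card (d ` y ` {1..n})"
      using x_ind(1) independent_span_bound[of "d ` y ` {1..n}" "x ` {1..r}"] by simp
    also have "\<dots> \<le> card {1..n}"
      unfolding image_image by (rule card_image_le) simp
    finally show ?thesis using x_ind(2) by (simp add: card_image)
  qed
  have y_C: "y i \<in> C (k + 1)" if "i \<in> {1..n}" for i
    using y that span_base[of "y i" "y ` {1..n}"] by (auto simp: orthogonal_basis_def basis_family_def)
  have x_C: "x i \<in> C k" if "i \<in> {1..m}" for i
    using x cycles_C that span_base[of "x i" "x ` {1..m}"]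
    by (auto simp: orthogonal_basis_def basis_family_def)
  have xy: "l (x i) \<le> l (y i)" if "i \<in> {1..r}" for i
    using filtration_d[OF y_C, of i] dy that rn by simp
  \<comment> \<open>\<open>S t\<close> indexes the cycles born by level \<open>t\<close> and
    \<open>T t\<close> those that have become boundaries; \<open>xy\<close> makes \<open>T t\<close>
    a subset of \<open>S t\<close>.\<close>
  define S where "S = (\<lambda>t. {i \<in> {1..m}. l (x i) \<le> ereal t})"
  define T where "T = (\<lambda>t. {i \<in> {1..r}. l (y i) \<le> ereal t})"
  have Z: "cycles (sublevel C l t) d k = span (x ` S t)" for t
  proof -
    have "cycles (sublevel C l t) d k = {v \<in> cycles C d k. l v \<le> ereal t}"
      by (auto simp: cycles_def sublevel_def)
    then show ?thesis
      using orthogonal_basis_sublevel[OF orthogonalizable cycles_C x] by (simp add: S_def)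
  qed
  have B: "boundaries (sublevel C l t) d k = span (x ` T t)" for t
  proof -
    let ?Y = "{i \<in> {1..n}. l (y i) \<le> ereal t}"
    have "boundaries (sublevel C l t) d k = span (d ` y ` ?Y)"
      using orthogonal_basis_sublevel[OF orthogonalizable subset_refl y]
      by (simp add: boundaries_def sublevel_def d.span_image)
    also have "\<dots> = span (x ` T t)"
      unfolding span_eq
    proof
      have "d (y i) \<in> span (x ` T t)" if i: "i \<in> ?Y" for i
      proof (cases "i \<le> r")
        case True
        then show ?thesis using i dy by (auto simp: T_def intro: span_base)
      next
        case False
        then have "y i \<in> {v \<in> C (k + 1). d v = 0}"
          using i y_ker span_base[of "y i" "y ` {r+1..n}"]
          by (auto simp: orthogonal_basis_def basis_family_def)
        then show ?thesis by (simp add: span_zero)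
      qed
      then show "d ` y ` ?Y \<subseteq> span (x ` T t)" by blast
      have "x i \<in> d ` y ` ?Y" if "i \<in> T t" for i
        using that rn dy[of i] by (auto simp: T_def intro!: image_eqI[of "x i" d "y i"])
      then show "x ` T t \<subseteq> span (d ` y ` ?Y)" using span_base by blast
    qed
    finally show ?thesis .
  qed
  \<comment> \<open>\<open>bar i\<close> is the lifespan of the class of \<open>x i\<close>, and
    \<open>J\<close> discards classes that die at birth.\<close>
  define bar where "bar = (\<lambda>i. {t. i \<in> S t - T t})"
  define J where "J = {i \<in> {1..m}. bar i \<noteq> {}}"
  let ?\<mu> = "count ({# {t. l (x i) \<le> ereal t \<and> ereal t < l (y i)}. i \<in># mset_set {i \<in> {1..r}. l (x i) < l (y i)} #}
              + {# {t. l (x i) \<le> ereal t}. i \<in># mset_set {r+1..m} #})"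
  have bar_le: "bar i = {t. l (x i) \<le> ereal t \<and> ereal t < l (y i)}" if "i \<in> {1..r}" for i
    using that rm by (auto simp: bar_def S_def T_def)
  have bar_gt: "bar i = {t. l (x i) \<le> ereal t}" if "i \<in> {r+1..m}" for i
    using that by (auto simp: bar_def S_def T_def)
  have J: "J = {i \<in> {1..r}. l (x i) < l (y i)} \<union> {r+1..m}"
  proof -
    \<comment> \<open>A real level exists strictly between any two distinct extended reals, so
      strict inequality of the endpoints already gives a nonempty bar.\<close>
    have "bar i \<noteq> {} \<longleftrightarrow> l (x i) < l (y i)" if "i \<in> {1..r}" for i
      using ereal_dense2[of "l (x i)" "l (y i)"]
      by (auto simp: bar_le[OF that] intro: less_imp_le)
    moreover have "bar i \<noteq> {}" if "i \<in> {r+1..m}" for i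
    proof -
      have "l (x i) \<noteq> \<infinity>"
        using x_C[of i] orthogonalizable[of k] that by (auto simp: orthogonalizable_def)
      then show ?thesis
        using ereal_dense2[of "l (x i)" \<infinity>] by (auto simp: bar_gt[OF that] intro: less_imp_le)
    qed
    moreover have "{1..m} = {1..r} \<union> {r+1..m}" using rm by auto
    ultimately show ?thesis unfolding J_def by blast
  qed
  have "finite J" by (simp add: J_def)
  \<comment> \<open>The two groups of bars have disjoint index sets, so together they are the image
    of \<open>J\<close> under \<open>bar\<close>, and multiplicities are fiber sizes.\<close>
  have \<mu>: "?\<mu> I = card {i \<in> J. bar i = I}" for I
  proof -
    have "image_mset bar (mset_set J) =
        image_mset bar (mset_set {i \<in> {1..r}. l (x i) < l (y i)}) + image_mset bar (mset_set {r+1..m})"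
      unfolding J by (subst mset_set_Union) auto
    also have "image_mset bar (mset_set {r+1..m}) = {# {t. l (x i) \<le> ereal t}. i \<in># mset_set {r+1..m} #}"
      by (intro image_mset_cong bar_gt) simp
    also have "image_mset bar (mset_set {i \<in> {1..r}. l (x i) < l (y i)}) =
        {# {t. l (x i) \<le> ereal t \<and> ereal t < l (y i)}. i \<in># mset_set {i \<in> {1..r}. l (x i) < l (y i)} #}"
      by (intro image_mset_cong bar_le) auto
    finally have "?\<mu> I = count (image_mset bar (mset_set J)) I" by simp
    also have "\<dots> = card (bar -` {I} \<inter> J)"
      using \<open>finite J\<close> by (simp add: count_image_mset)
    also have "bar -` {I} \<inter> J = {i \<in> J. bar i = I}" by auto
    finally show ?thesis .
  qed
  obtain \<sigma> where \<sigma>: "bij_betw \<sigma> {(I, j). j < ?\<mu> I} J"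
    "\<And>p. p \<in> {(I, j). j < ?\<mu> I} \<Longrightarrow> bar (\<sigma> p) = fst p"
    using fiber_index_bij[OF \<open>finite J\<close>, of bar] unfolding \<mu> by blast
  have iso: "pm_iso (interval_sum {(I, j). j < ?\<mu> I} fst) (persistent_homology s C d l k)"
    unfolding persistent_homology_def Let_def
  proof (rule interval_sum_iso_quotient[where E = "{1..m}" and x = x and S = S and T = T and \<sigma> = \<sigma>])
    show "inj_on x {1..m}" "independent (x ` {1..m})"
      using x by (auto simp: orthogonal_basis_def basis_family_def)
    show "T t \<subseteq> S t" for t
      using rm xy by (auto simp: S_def T_def intro: order_trans)
    show "bij_betw \<sigma> {(I, j). j < ?\<mu> I} {i \<in> {1..m}. {t. i \<in> S t - T t} \<noteq> {}}"
      using \<sigma>(1) unfolding J_def bar_def .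
    show "fst p = {t. \<sigma> p \<in> S t - T t}" if "p \<in> {(I, j). j < ?\<mu> I}" for p
      using \<sigma>(2)[OF that] by (simp add: bar_def)
    show "S a \<subseteq> S b" "T a \<subseteq> T b" if "a \<le> b" for a b
      using that unfolding S_def T_def by (auto elim: order_trans)
  qed (auto simp: S_def Z B)
  have int: "is_interval I \<and> I \<noteq> {}" if "?\<mu> I \<noteq> 0" for I
  proof -
    have "{i \<in> J. bar i = I} \<noteq> {}" using that unfolding \<mu> by (metis card.empty)
    then obtain i where i: "i \<in> J" "I = bar i" by blast
    \<comment> \<open>Both \<open>S\<close> and \<open>T\<close> grow with the level: a class alive
      at two levels is already born, and not yet killed, at every level between them.\<close>
    have "is_interval (bar i)"
      unfolding is_interval_1 bar_def S_def T_def
      by (auto simp: not_le) (meson ereal_less_eq(3) le_less_trans order_trans not_le)+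
    then show ?thesis using i by (simp add: J_def)
  qed
  have "finite {I. count M I \<noteq> 0}" for M :: "real set multiset"
    by (simp add: count_eq_zero_iff)
  then have supp: "finite {I. ?\<mu> I \<noteq> 0}" .
  have eq: "(\<lambda>(I, j :: nat). interval_module I :: ('k, 'k) persistence_module) = (\<lambda>i. interval_module (fst i))"
    by auto
  show ?thesis
    unfolding is_barcode_def interval_decomposition_def[of _ ?\<mu>] eq
  proof (intro conjI allI impI)
    show "is_interval I" "I \<noteq> {}" if "?\<mu> I \<noteq> 0" for I
      using int[OF that] by simp_all
    show "pm_iso (persistent_homology s C d l k) (interval_sum {(I, j). j < ?\<mu> I} fst)"
      by (rule interval_sum_iso_sym[OF iso])
    show "\<mu>' = ?\<mu>" if "interval_decomposition (persistent_homology s C d l k) \<mu>'" for \<mu>'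
      by (rule interval_decomposition_unique[OF iso int supp that])
  qed
qed

end
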